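(* Let $T$ be a three-colorable triangulation of a closed orientable surface. If $f$ and $g$ are two four-colorings of $T$ related by a Kempe change on a region $R$, then $$\deg(g)\equiv \deg(f) \pmod{12}.$$
   Context: A triangulation is called three-colorable if its vertices admit a proper coloring with three colors. A four-coloring of a triangulation $T$ is a proper vertex coloring $f:V(T)\to\{1,2,3,4\}$ (adjacent vertices receive different colors); equivalently, a non-degenerate simplicial map $f:T\to\partial\Delta^3$, where $\partial\Delta^3$ is the boundary of the tetrahedron with vertices $1,2,3,4$. Degree: fix an orientation of the surface and an orientation of $\partial\Delta^3$. For a triangle $t$ of $\partial\Delta^3$ let $p$ (resp. $n$) be the number of triangles of $T$ mapped by $f$ onto $t$ with orientation preserved (resp. reversed). Then $\deg(f)=p-n$; this does not depend on $t$. (Reversing a chosen orientation changes only the sign of the degree. The same orientations are used for all four-colorings of $T$.) For instance, $\deg(f)$ can be computed as the number of triangles whose colors read $1,2,3$ in clockwise order minus the number of triangles whose colors read $1,3,2$ in clockwise order. Kempe change on a region: a region $R$ of $T$ is a union of triangles of $T$. If $f$ uses only two colors on the boundary $\partial R$, the Kempe change on $R$ produces the coloring $g$ that equals $f$ outside $R$ and equals $\pi\circ f$ on $R$, where $\pi$ is the transposition interchanging the two colors not used on $\partial R$ (the colors on $\partial R$ are not changed). Every interchange of two colors $a,b$ on a connected component of the subgraph induced by the vertices colored $a$ or $b$ is of this form. *)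

theory Defs
  imports "HOL-Number_Theory.Cong" "HOL-Combinatorics.Transposition"
begin

definition simplicial_complex :: "'a set set \<Rightarrow> bool" where
  "simplicial_complex K \<longleftrightarrow>
     (\<forall>s\<in>K. finite s \<and> s \<noteq> {}) \<and>
     (\<forall>s\<in>K. \<forall>r. r \<subseteq> s \<and> r \<noteq> {} \<longrightarrow> r \<in> K)"

definition vertices :: "'a set set \<Rightarrow> 'a set" where
  "vertices K = \<Union>K"

definition triangles :: "'a set set \<Rightarrow> 'a set set" where
  "triangles K = {s \<in> K. card s = 3}"

definition link :: "'a set set \<Rightarrow> 'a \<Rightarrow> 'a set set" where
  "link K v = {s. s \<noteq> {} \<and> v \<notin> s \<and> insert v s \<in> K}"

text \<open>A complex that is a cycle of length at least three (a triangulated circle).\<close>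

definition is_cycle :: "'a set set \<Rightarrow> bool" where
  "is_cycle L \<longleftrightarrow>
     (\<exists>us. length us \<ge> 3 \<and> distinct us \<and>
        L = {{us ! i} | i. i < length us} \<union>
            {{us ! i, us ! (Suc i mod length us)} | i. i < length us})"

text \<open>Triangulations of closed (compact, connected, boundaryless) surfaces: finite connected
  complexes in which every vertex link is a circle. The link condition forces the complex to be
  purely two-dimensional with every edge in exactly two triangles. In the connectedness
  condition the pairs with \<open>x = y\<close> are harmless.\<close>

definition closed_surface_triangulation :: "'a set set \<Rightarrow> bool" where
  "closed_surface_triangulation T \<longleftrightarrow>
     simplicial_complex T \<and> finite T \<and> T \<noteq> {} \<and>
     (\<forall>v \<in> vertices T. is_cycle (link T v)) \<and>
     (\<forall>u \<in> vertices T. \<forall>v \<in> vertices T. (u, v) \<in> {(x, y). {x, y} \<in> T}\<^sup>*)"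

text \<open>An orientation is given by the set of positively ordered triples: it selects one of the two
  cyclic orders of every triangle, in such a way that two different triangles with a common edge
  induce opposite directions on that edge. A surface is orientable iff such a set exists.\<close>

definition orientation :: "'a set set \<Rightarrow> ('a \<times> 'a \<times> 'a) set \<Rightarrow> bool" where
  "orientation K Or \<longleftrightarrow>
     (\<forall>x y z. (x, y, z) \<in> Or \<longrightarrow> {x, y, z} \<in> triangles K \<and> (y, z, x) \<in> Or) \<and>
     (\<forall>x y z. {x, y, z} \<in> triangles K \<longrightarrow> ((x, y, z) \<in> Or \<longleftrightarrow> (x, z, y) \<notin> Or)) \<and>
     (\<forall>x y z w. (x, y, z) \<in> Or \<and> (x, y, w) \<in> Or \<longrightarrow> z = w)"

definition orientable :: "'a set set \<Rightarrow> bool" where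
  "orientable K \<longleftrightarrow> (\<exists>Or. orientation K Or)"

definition proper_coloring :: "'a set set \<Rightarrow> nat set \<Rightarrow> ('a \<Rightarrow> nat) \<Rightarrow> bool" where
  "proper_coloring T C f \<longleftrightarrow>
     f ` vertices T \<subseteq> C \<and> (\<forall>u v. u \<noteq> v \<and> {u, v} \<in> T \<longrightarrow> f u \<noteq> f v)"

definition three_colorable :: "'a set set \<Rightarrow> bool" where
  "three_colorable T \<longleftrightarrow> (\<exists>c. proper_coloring T {1, 2, 3} c)"

definition four_coloring :: "'a set set \<Rightarrow> ('a \<Rightarrow> nat) \<Rightarrow> bool" where
  "four_coloring T f \<longleftrightarrow> proper_coloring T {1, 2, 3, 4} f"

definition tetrahedron_boundary :: "nat set set" where
  "tetrahedron_boundary = {s. s \<noteq> {} \<and> s \<subset> {1, 2, 3, 4}}"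

text \<open>The triangles of \<open>T\<close> mapped by \<open>f\<close> onto \<open>t\<close> with orientation preserved, respectively
  reversed, and the degree \<open>p - n\<close> counted over the triangle \<open>t\<close> of the tetrahedron. Here \<open>Or\<close>
  orients the surface and \<open>Q\<close> orients the boundary of the tetrahedron. The value does not
  depend on the choice of \<open>t\<close>.\<close>

definition preserved_triangles ::
  "'a set set \<Rightarrow> ('a \<times> 'a \<times> 'a) set \<Rightarrow> (nat \<times> nat \<times> nat) set \<Rightarrow> nat set \<Rightarrow> ('a \<Rightarrow> nat) \<Rightarrow> 'a set set"
  where
  "preserved_triangles T Or Q t f =
     {s \<in> triangles T. f ` s = t \<and>
        (\<exists>x y z. s = {x, y, z} \<and> (x, y, z) \<in> Or \<and> (f x, f y, f z) \<in> Q)}"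

definition reversed_triangles ::
  "'a set set \<Rightarrow> ('a \<times> 'a \<times> 'a) set \<Rightarrow> (nat \<times> nat \<times> nat) set \<Rightarrow> nat set \<Rightarrow> ('a \<Rightarrow> nat) \<Rightarrow> 'a set set"
  where
  "reversed_triangles T Or Q t f =
     {s \<in> triangles T. f ` s = t \<and>
        (\<exists>x y z. s = {x, y, z} \<and> (x, y, z) \<in> Or \<and> (f x, f z, f y) \<in> Q)}"

definition deg ::
  "'a set set \<Rightarrow> ('a \<times> 'a \<times> 'a) set \<Rightarrow> (nat \<times> nat \<times> nat) set \<Rightarrow> nat set \<Rightarrow> ('a \<Rightarrow> nat) \<Rightarrow> int"
  where
  "deg T Or Q t f =
     int (card (preserved_triangles T Or Q t f)) - int (card (reversed_triangles T Or Q t f))"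

text \<open>A region is represented by its set \<open>R\<close> of triangles. Its boundary is the topological
  frontier of the union of these triangles: the simplices lying both in a triangle of \<open>R\<close> and in
  a triangle outside \<open>R\<close>.\<close>

definition region_boundary :: "'a set set \<Rightarrow> 'a set set \<Rightarrow> 'a set set" where
  "region_boundary T R =
     {s \<in> T. (\<exists>t \<in> R. s \<subseteq> t) \<and> (\<exists>t \<in> triangles T - R. s \<subseteq> t)}"

text \<open>The boundary uses only the two colors other than \<open>a\<close> and \<open>b\<close>. If it is empty (\<open>R\<close> contains
  no or all triangles), then \<open>a\<close> and \<open>b\<close> may be any two colors.\<close>

definition kempe_change :: "'a set set \<Rightarrow> 'a set set \<Rightarrow> ('a \<Rightarrow> nat) \<Rightarrow> ('a \<Rightarrow> nat) \<Rightarrow> bool" where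
  "kempe_change T R f g \<longleftrightarrow>
     R \<subseteq> triangles T \<and>
     (\<exists>a b. a \<in> {1, 2, 3, 4} \<and> b \<in> {1, 2, 3, 4} \<and> a \<noteq> b \<and>
        f ` vertices (region_boundary T R) \<subseteq> {1, 2, 3, 4} - {a, b} \<and>
        (\<forall>v \<in> vertices T. g v = (if v \<in> \<Union>R then transpose a b (f v) else f v)))"

end

theory Submission
  imports Defs
begin

text \<open>Fix a proper colouring \<open>c\<close> with colours 1, 2, 3 and list the vertices of every triangle of
  \<open>R\<close> in the order of their \<open>c\<close>-colours, so that \<open>f\<close> turns the triangle into one of the 24 triples
  of distinct colours. Count the triangles over each triple with their sign, multiplied by the
  orientation sign of the triple in the tetrahedron. Two triples that differ in one entry get the
  same count, because every edge lies in two triangles of opposite sign; only edges on \<open>\<partial>R\<close>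
  could spoil this, and they carry the two colours \<open>p, q\<close> that are not interchanged. The
  admissible moves connect all 24 triples, so all counts are equal to a number \<open>m\<close>. Each triangle
  of the tetrahedron carries six triples, so \<open>R\<close> contributes \<open>6 m\<close> to the degree of \<open>f\<close>. After the
  Kempe change it contributes \<open>- 6 m\<close>.\<close>

section \<open>Signs of ordered triples under an orientation\<close>

text \<open>Every triple outside \<open>Or\<close> gets the value -1, so this is a genuine sign only
  when the three entries form a triangle.\<close>

definition osign :: "('a \<times> 'a \<times> 'a) set \<Rightarrow> 'a \<Rightarrow> 'a \<Rightarrow> 'a \<Rightarrow> int" where
  "osign Or x y z = (if (x, y, z) \<in> Or then 1 else - 1)"

lemma orientationD:
  assumes "orientation K Or"
  shows orientation_rotate: "(x, y, z) \<in> Or \<Longrightarrow> (y, z, x) \<in> Or"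
    and orientation_swap: "{x, y, z} \<in> triangles K \<Longrightarrow> (x, z, y) \<in> Or \<longleftrightarrow> (x, y, z) \<notin> Or"
    and orientation_unique: "(x, y, z) \<in> Or \<Longrightarrow> (x, y, w) \<in> Or \<Longrightarrow> z = w"
proof -
  note D = assms[unfolded orientation_def]
  have rot: "\<forall>x y z. (x, y, z) \<in> Or \<longrightarrow> {x, y, z} \<in> triangles K \<and> (y, z, x) \<in> Or"
    and swap: "\<forall>x y z. {x, y, z} \<in> triangles K \<longrightarrow> ((x, y, z) \<in> Or \<longleftrightarrow> (x, z, y) \<notin> Or)"
    and uniq: "\<forall>x y z w. (x, y, z) \<in> Or \<and> (x, y, w) \<in> Or \<longrightarrow> z = w"
    by (fact D[THEN conjunct1] D[THEN conjunct2, THEN conjunct1] D[THEN conjunct2, THEN conjunct2])+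
  show "(x, y, z) \<in> Or \<Longrightarrow> (y, z, x) \<in> Or"
    using rot by blast
  show "{x, y, z} \<in> triangles K \<Longrightarrow> (x, z, y) \<in> Or \<longleftrightarrow> (x, y, z) \<notin> Or"
    using swap[rule_format, of x y z] by blast
  show "(x, y, z) \<in> Or \<Longrightarrow> (x, y, w) \<in> Or \<Longrightarrow> z = w"
    using uniq[rule_format, of x y z w] by blast
qed

lemma osign_rotate:
  assumes "orientation K Or"
  shows "osign Or y z x = osign Or x y z"
  using orientation_rotate[OF assms, of x y z] orientation_rotate[OF assms, of y z x]
    orientation_rotate[OF assms, of z x y] by (auto simp: osign_def)

lemma osign_swap:
  assumes "orientation K Or" and "{x, y, z} \<in> triangles K"
  shows "osign Or x z y = - osign Or x y z"
  using orientation_swap[OF assms] by (auto simp: osign_def)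

text \<open>At most one positive triple lies over each directed edge. Two signs +1 contradict this
  for the direction from \<open>x\<close> to \<open>y\<close>. If both signs are -1, the reversed
  triples are positive and contradict it for the direction from \<open>y\<close> to
  \<open>x\<close>.\<close>

lemma osign_adjacent:
  assumes O: "orientation K Or"
    and z: "{x, y, z} \<in> triangles K" and w: "{x, y, w} \<in> triangles K" and "z \<noteq> w"
  shows "osign Or x y w = - osign Or x y z"
proof -
  have rev: "(y, x, v) \<in> Or" if "{x, y, v} \<in> triangles K" "(x, y, v) \<notin> Or" for v
    using that orientation_swap[OF O that(1)] orientation_rotate[OF O, of x v y]
      orientation_rotate[OF O, of v y x] by simp
  have "((x, y, z) \<in> Or) \<noteq> ((x, y, w) \<in> Or)"
    using orientation_unique[OF O, of x y z w] orientation_unique[OF O, of y x z w]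
      rev[OF z] rev[OF w] \<open>z \<noteq> w\<close> by blast
  then show ?thesis
    by (auto simp: osign_def)
qed

section \<open>Triangles, colourings and edges of a closed surface\<close>

lemma triangle_distinct:
  assumes "{x, y, z} \<in> triangles K"
  shows "x \<noteq> y" "x \<noteq> z" "y \<noteq> z"
  using assms by (auto simp: triangles_def card_insert_if split: if_splits)

lemma finite_triangle: "s \<in> triangles K \<Longrightarrow> finite s"
  by (simp add: triangles_def card_ge_0_finite)

lemma face_mem:
  assumes "simplicial_complex K" "s \<in> K" "r \<subseteq> s" "r \<noteq> {}"
  shows "r \<in> K"
  using assms unfolding simplicial_complex_def by blast

lemma proper_coloring_triangle:
  assumes "simplicial_complex K" "proper_coloring K C f" "{x, y, z} \<in> triangles K"
  shows "distinct [f x, f y, f z]" "{f x, f y, f z} \<subseteq> C"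
proof -
  have K: "{x, y, z} \<in> K"
    using assms(3) by (simp add: triangles_def)
  then have "{x, y} \<in> K" "{x, z} \<in> K" "{y, z} \<in> K"
    by (auto intro: face_mem[OF assms(1) K])
  then show "distinct [f x, f y, f z]"
    using assms(2) triangle_distinct[OF assms(3)] unfolding proper_coloring_def by auto
  show "{f x, f y, f z} \<subseteq> C"
    using assms(2) K unfolding proper_coloring_def vertices_def by blast
qed

text \<open>The neighbours are the successor and the predecessor in the cyclic list; they differ
  because its length is at least three.\<close>

lemma is_cycle_two_neighbours:
  assumes "is_cycle L" and "{v} \<in> L"
  obtains w w' where "w \<noteq> w'" "w \<noteq> v" "w' \<noteq> v" "{v, w} \<in> L" "{v, w'} \<in> L"
proof -
  obtain us where us: "length us \<ge> 3" "distinct us" and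
    L: "L = {{us ! i} | i. i < length us} \<union> {{us ! i, us ! (Suc i mod length us)} | i. i < length us}"
    using assms(1) unfolding is_cycle_def by blast
  define n where "n = length us"
  have n: "n \<ge> 3" using us n_def by simp
  have nth_eq: "us ! i = us ! j \<longleftrightarrow> i = j" if "i < n" "j < n" for i j
    using us that by (simp add: nth_eq_iff_index_eq n_def)
  have lt: "Suc i mod n < n" and ne: "Suc i mod n \<noteq> i" if "i < n" for i
    using n that by (auto simp: mod_Suc)
  have "\<exists>i<n. v = us ! i"
  proof -
    from assms(2) consider i where "i < n" "{v} = {us ! i}"
      | i where "i < n" "{v} = {us ! i, us ! (Suc i mod n)}"
      unfolding L n_def by blast
    then show ?thesis by cases auto
  qed
  then obtain i where i: "i < n" "v = us ! i" by blast
  \<comment> \<open>The predecessor of \<open>i\<close> modulo \<open>n\<close>. The case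
    \<open>i = 0\<close> is separate because \<open>i - 1\<close> would truncate to 0.\<close>
  define j where "j = (if i = 0 then n - 1 else i - 1)"
  have j: "j < n" "Suc j mod n = i" "j \<noteq> i" "j \<noteq> Suc i mod n"
    using i n by (auto simp: j_def mod_Suc)
  have edge: "{us ! k, us ! (Suc k mod n)} \<in> L" if "k < n" for k
    using that unfolding L n_def by blast
  show thesis
  proof
    show "us ! (Suc i mod n) \<noteq> us ! j" "us ! (Suc i mod n) \<noteq> v" "us ! j \<noteq> v"
      using i j lt ne by (auto simp: nth_eq)
    show "{v, us ! (Suc i mod n)} \<in> L" "{v, us ! j} \<in> L"
      using edge[of i] edge[of j] i j by (auto simp: insert_commute)
  qed
qed

text \<open>The vertex \<open>y\<close> lies on the circle \<open>link T x\<close>, and its two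
  neighbours there span two different triangles on the edge \<open>{x, y}\<close>. At least one of
  them is not the given triangle.\<close>

lemma edge_in_two_triangles:
  assumes T: "closed_surface_triangulation T" and t: "{x, y, z} \<in> triangles T"
  obtains w where "w \<noteq> z" "{x, y, w} \<in> triangles T"
proof -
  have S: "simplicial_complex T"
    and cyc: "\<And>v. v \<in> vertices T \<Longrightarrow> is_cycle (link T v)"
    using T unfolding closed_surface_triangulation_def by auto
  note d = triangle_distinct[OF t]
  have tT: "{x, y, z} \<in> T"
    using t by (simp add: triangles_def)
  then have "{x, y} \<in> T"
    by (rule face_mem[OF S]) auto
  with d have y: "{y} \<in> link T x"
    by (simp add: link_def)
  have "is_cycle (link T x)"
    by (rule cyc) (use tT in \<open>auto simp: vertices_def\<close>)
  then obtain w w' where w: "w \<noteq> w'" "w \<noteq> y" "w' \<noteq> y" "{y, w} \<in> link T x" "{y, w'} \<in> link T x"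
    using is_cycle_two_neighbours[OF _ y] by metis
  then have "{x, y, w} \<in> triangles T" "{x, y, w'} \<in> triangles T"
    using d by (auto simp: link_def triangles_def card_insert_if)
  then show thesis
    using w that by metis
qed

section \<open>Cancellation of signs across edges\<close>

text \<open>Off the boundary, \<open>R\<close> contains all triangles on the edge or none. If it
  contains any, there are exactly two, with opposite signs.\<close>

lemma sum_osign_edge:
  assumes T: "closed_surface_triangulation T" and O: "orientation T Or" and R: "R \<subseteq> triangles T"
    and inner: "{x, y} \<notin> region_boundary T R"
  shows "(\<Sum>z | {x, y, z} \<in> R. osign Or x y z) = 0"
proof (cases "\<exists>z. {x, y, z} \<in> R")
  case True
  then obtain z where z: "{x, y, z} \<in> R" by blast
  then have zT: "{x, y, z} \<in> triangles T" using R by blast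
  obtain w where w: "w \<noteq> z" "{x, y, w} \<in> triangles T"
    using edge_in_two_triangles[OF T zT] by metis
  have "simplicial_complex T"
    using T unfolding closed_surface_triangulation_def by simp
  then have "{x, y} \<in> T"
    by (rule face_mem[of _ "{x, y, z}"]) (use zT in \<open>auto simp: triangles_def\<close>)
  moreover have "{x, y} \<subseteq> {x, y, z}" "{x, y} \<subseteq> {x, y, w}" by auto
  ultimately have wR: "{x, y, w} \<in> R"
    using inner z w unfolding region_boundary_def by blast
  have sw: "osign Or x y w = - osign Or x y z"
    using osign_adjacent[OF O zT w(2)] w by metis
  \<comment> \<open>No third triangle fits on the edge: its sign would have to be opposite to each
    of two opposite signs.\<close>
  have "v \<in> {z, w}" if v: "{x, y, v} \<in> R" for v
  proof (rule ccontr)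
    assume "v \<notin> {z, w}"
    then have "osign Or x y v = - osign Or x y z" "osign Or x y v = - osign Or x y w"
      using osign_adjacent[OF O] zT w v R by (metis insertCI subset_iff)+
    with sw show False
      by (auto simp: osign_def split: if_splits)
  qed
  with z wR have "{z. {x, y, z} \<in> R} = {z, w}" by blast
  with sw w show ?thesis by simp
qed simp

text \<open>The label \<open>h x\<close> of a vertex will be the pair of its \<open>c\<close>-colour and its \<open>f\<close>-colour.\<close>

definition signed_count ::
  "('a \<times> 'a \<times> 'a) set \<Rightarrow> 'a set set \<Rightarrow> ('a \<Rightarrow> 'b) \<Rightarrow> 'b \<Rightarrow> 'b \<Rightarrow> 'b \<Rightarrow> int" where
  "signed_count Or R h \<alpha> \<beta> \<gamma> =
     (\<Sum>(x, y, z) | {x, y, z} \<in> R \<and> h x = \<alpha> \<and> h y = \<beta> \<and> h z = \<gamma>. osign Or x y z)"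

lemma finite_triples:
  assumes "finite T" and "R \<subseteq> triangles T"
  shows "finite {(x, y, z). {x, y, z} \<in> R}"
proof (rule finite_subset)
  have "R \<subseteq> T"
    using assms(2) by (auto simp: triangles_def)
  then have "finite (\<Union>R)"
    using assms finite_subset finite_triangle by (metis finite_Union subsetD)
  then show "finite (\<Union>R \<times> \<Union>R \<times> \<Union>R)" by simp
qed auto

text \<open>Brings any entry of a triple to the last position, the one treated by
  \<open>signed_count_edge\<close>.\<close>

lemma signed_count_rotate:
  assumes "orientation T Or"
  shows "signed_count Or R h \<beta> \<gamma> \<alpha> = signed_count Or R h \<alpha> \<beta> \<gamma>"
  unfolding signed_count_def
  by (rule sum.reindex_bij_witness[of _ "\<lambda>(x, y, z). (y, z, x)" "\<lambda>(y, z, x). (x, y, z)"])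
     (auto simp: insert_commute osign_rotate[OF assms])

text \<open>By \<open>third\<close>, the triples over the two patterns together run through all
  triangles of \<open>R\<close> on directed edges labelled \<open>\<alpha>\<close>,
  \<open>\<beta>\<close>. Grouped by these edges, the signs cancel in every group.\<close>

lemma signed_count_edge:
  assumes T: "closed_surface_triangulation T" and O: "orientation T Or" and R: "R \<subseteq> triangles T"
    and inner: "\<And>x y. h x = \<alpha> \<Longrightarrow> h y = \<beta> \<Longrightarrow> {x, y} \<notin> region_boundary T R"
    and third: "\<And>x y z. {x, y, z} \<in> R \<Longrightarrow> h x = \<alpha> \<Longrightarrow> h y = \<beta> \<Longrightarrow> h z = \<gamma> \<or> h z = \<gamma>'"
    and "\<gamma> \<noteq> \<gamma>'"
  shows "signed_count Or R h \<alpha> \<beta> \<gamma> + signed_count Or R h \<alpha> \<beta> \<gamma>' = 0"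
proof -
  let ?A = "\<lambda>\<gamma>. {(x, y, z). {x, y, z} \<in> R \<and> h x = \<alpha> \<and> h y = \<beta> \<and> h z = \<gamma>}"
  let ?E = "{(x, y). (\<exists>z. {x, y, z} \<in> R) \<and> h x = \<alpha> \<and> h y = \<beta>}"
  have "finite T"
    using T unfolding closed_surface_triangulation_def by simp
  note fin = finite_triples[OF this R]
  have finA: "finite (?A \<gamma>)" for \<gamma>
    by (rule finite_subset[OF _ fin]) auto
  have finE: "finite ?E"
    by (rule finite_subset[OF _ finite_imageI[OF fin, of "\<lambda>(x, y, z). (x, y)"]])
       (auto intro!: image_eqI[rotated])
  have finZ: "finite {z. {x, y, z} \<in> R}" for x y
    by (rule finite_subset[OF _ finite_imageI[OF fin, of "\<lambda>(x, y, z). z"]])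
       (auto intro!: image_eqI[rotated])
  have "signed_count Or R h \<alpha> \<beta> \<gamma> + signed_count Or R h \<alpha> \<beta> \<gamma>'
      = (\<Sum>(x, y, z) \<in> ?A \<gamma> \<union> ?A \<gamma>'. osign Or x y z)"
    unfolding signed_count_def
    by (rule sum.union_disjoint[symmetric]) (use finA \<open>\<gamma> \<noteq> \<gamma>'\<close> in auto)
  also have "\<dots> = (\<Sum>(e, z) \<in> Sigma ?E (\<lambda>(x, y). {z. {x, y, z} \<in> R}). osign Or (fst e) (snd e) z)"
    by (rule sum.reindex_bij_witness[of _ "\<lambda>(e, z). (fst e, snd e, z)" "\<lambda>(x, y, z). ((x, y), z)"])
       (use third in auto)
  also have "\<dots> = (\<Sum>e \<in> ?E. \<Sum>z \<in> (\<lambda>(x, y). {z. {x, y, z} \<in> R}) e. osign Or (fst e) (snd e) z)"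
    by (rule sum.Sigma[symmetric]) (use finE finZ in auto)
  also have "\<dots> = 0"
    by (rule sum.neutral) (use inner sum_osign_edge[OF T O R] in auto)
  finally show ?thesis .
qed

section \<open>The degree as a sum of signs\<close>

lemma osign_permutations:
  assumes "orientation K Or" and "{x, y, z} \<in> triangles K"
  shows "osign Or y z x = osign Or x y z" "osign Or z x y = osign Or x y z"
    "osign Or x z y = - osign Or x y z" "osign Or z y x = - osign Or x y z"
    "osign Or y x z = - osign Or x y z"
  using osign_rotate[OF assms(1)] osign_swap[OF assms] by metis+

lemma triple_permutations:
  assumes "{x', y', z'} = {x, y, z}" "distinct [x, y, z]"
  shows "(x', y', z') \<in> {(x, y, z), (y, z, x), (z, x, y), (x, z, y), (z, y, x), (y, x, z)}"
proof -
  have "card {x', y', z'} = 3"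
    using assms by simp
  then have "distinct [x', y', z']"
    by (auto simp: card_insert_if split: if_splits)
  moreover have "x' \<in> {x, y, z}" "y' \<in> {x, y, z}" "z' \<in> {x, y, z}"
    using assms(1) by blast+
  ultimately show ?thesis
    by auto
qed

lemma triangles_tetrahedron_boundary:
  "{u, v, w} \<in> triangles tetrahedron_boundary \<longleftrightarrow> distinct [u, v, w] \<and> {u, v, w} \<subseteq> {1, 2, 3, 4}"
proof -
  have "{u, v, w} \<noteq> {1, 2, 3, 4 :: nat}"
  proof
    assume "{u, v, w} = {1, 2, 3, 4}"
    then have "card {u, v, w} = 4" by simp
    then show False by (simp add: card_insert_if split: if_splits)
  qed
  then have "{u, v, w} \<in> tetrahedron_boundary \<longleftrightarrow> {u, v, w} \<subseteq> {1, 2, 3, 4}"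
    unfolding tetrahedron_boundary_def psubset_eq by blast
  then show ?thesis
    by (auto simp: triangles_def card_insert_if)
qed

text \<open>Additive in \<open>S\<close>, so that the degree splits into a part over a region and a
  part over its complement.\<close>

definition deg_on ::
  "'a set set \<Rightarrow> ('a \<times> 'a \<times> 'a) set \<Rightarrow> (nat \<times> nat \<times> nat) set \<Rightarrow> nat set \<Rightarrow> ('a \<Rightarrow> nat) \<Rightarrow> 'a set set \<Rightarrow> int"
  where
  "deg_on T Or Q t f S =
     (\<Sum>s\<in>S. of_bool (s \<in> preserved_triangles T Or Q t f) - of_bool (s \<in> reversed_triangles T Or Q t f))"

lemma deg_eq_deg_on:
  assumes "finite T"
  shows "deg T Or Q t f = deg_on T Or Q t f (triangles T)"
proof -
  have "finite (triangles T)"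
    using assms by (simp add: triangles_def)
  moreover have "preserved_triangles T Or Q t f \<subseteq> triangles T"
    "reversed_triangles T Or Q t f \<subseteq> triangles T"
    by (auto simp: preserved_triangles_def reversed_triangles_def)
  ultimately show ?thesis
    by (simp add: deg_def deg_on_def sum_subtractf Int_absorb1 Int_def[symmetric] flip: of_bool_def)
qed

lemma deg_on_cong:
  assumes "\<And>x. x \<in> \<Union>S \<Longrightarrow> f x = g x"
  shows "deg_on T Or Q t f S = deg_on T Or Q t g S"
proof -
  have "s \<in> preserved_triangles T Or Q t f \<longleftrightarrow> s \<in> preserved_triangles T Or Q t g"
    "s \<in> reversed_triangles T Or Q t f \<longleftrightarrow> s \<in> reversed_triangles T Or Q t g" if "s \<in> S" for s
  proof -
    have eq: "f x = g x" if "x \<in> s" for x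
      using assms that \<open>s \<in> S\<close> by blast
    then have "f ` s = g ` s" by simp
    moreover have "f x = g x \<and> f y = g y \<and> f z = g z" if "s = {x, y, z}" for x y z
      using eq that by simp
    ultimately show "s \<in> preserved_triangles T Or Q t f \<longleftrightarrow> s \<in> preserved_triangles T Or Q t g"
      "s \<in> reversed_triangles T Or Q t f \<longleftrightarrow> s \<in> reversed_triangles T Or Q t g"
      unfolding preserved_triangles_def reversed_triangles_def mem_Collect_eq by metis+
  qed
  then show ?thesis
    unfolding deg_on_def by (intro sum.cong) auto
qed

text \<open>Preserved and reversed triangles are defined by the existence of a suitable ordering.
  Reordering the vertices changes both orientation signs by the same factor, so their product can be
  read off from any one ordering.\<close>

lemma triangle_contribution:
  assumes O: "orientation T Or" and Q: "orientation tetrahedron_boundary Q"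
    and s: "{x, y, z} \<in> triangles T" and fs: "{f x, f y, f z} \<in> triangles tetrahedron_boundary"
  shows "of_bool ({x, y, z} \<in> preserved_triangles T Or Q t f)
       - of_bool ({x, y, z} \<in> reversed_triangles T Or Q t f)
     = (if {f x, f y, f z} = t then osign Or x y z * osign Q (f x) (f y) (f z) else 0)"
proof -
  let ?sgn = "\<lambda>x y z. osign Or x y z * osign Q (f x) (f y) (f z)"
  have inv: "?sgn x' y' z' = ?sgn x y z" "osign Q (f x') (f z') (f y') = - osign Q (f x') (f y') (f z')"
    if "{x, y, z} = {x', y', z'}" for x' y' z'
  proof -
    have "(x', y', z') \<in> {(x, y, z), (y, z, x), (z, x, y), (x, z, y), (z, y, x), (y, x, z)}"
      by (rule triple_permutations) (use that triangle_distinct[OF s] in auto)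
    then show "?sgn x' y' z' = ?sgn x y z"
      "osign Q (f x') (f z') (f y') = - osign Q (f x') (f y') (f z')"
      by (elim insertE emptyE; simp add: osign_permutations[OF O s] osign_permutations[OF Q fs])+
  qed
  have pres: "{x, y, z} \<in> preserved_triangles T Or Q t f \<longleftrightarrow> {f x, f y, f z} = t \<and> ?sgn x y z = 1"
  proof
    assume "{x, y, z} \<in> preserved_triangles T Or Q t f"
    then obtain x' y' z' where e: "{x, y, z} = {x', y', z'}" "(x', y', z') \<in> Or"
      "(f x', f y', f z') \<in> Q" and "f ` {x, y, z} = t"
      unfolding preserved_triangles_def by blast
    then show "{f x, f y, f z} = t \<and> ?sgn x y z = 1"
      using inv(1)[OF e(1)] by (auto simp: osign_def)
  next
    assume a: "{f x, f y, f z} = t \<and> ?sgn x y z = 1"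
    \<comment> \<open>If both signs are -1, exchanging \<open>y\<close> and \<open>z\<close> makes
      both triples positive and supplies the witness.\<close>
    then have "(x, y, z) \<in> Or \<and> (f x, f y, f z) \<in> Q \<or> (x, z, y) \<in> Or \<and> (f x, f z, f y) \<in> Q"
      using orientation_swap[OF O s] orientation_swap[OF Q fs]
      by (auto simp: osign_def split: if_splits)
    moreover have "{x, y, z} = {x, z, y}" by auto
    ultimately show "{x, y, z} \<in> preserved_triangles T Or Q t f"
      using a s unfolding preserved_triangles_def by auto
  qed
  have rev: "{x, y, z} \<in> reversed_triangles T Or Q t f \<longleftrightarrow> {f x, f y, f z} = t \<and> ?sgn x y z = - 1"
  proof
    assume "{x, y, z} \<in> reversed_triangles T Or Q t f"
    then obtain x' y' z' where e: "{x, y, z} = {x', y', z'}" "(x', y', z') \<in> Or"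
      "(f x', f z', f y') \<in> Q" and "f ` {x, y, z} = t"
      unfolding reversed_triangles_def by blast
    then show "{f x, f y, f z} = t \<and> ?sgn x y z = - 1"
      using inv[OF e(1)] by (auto simp: osign_def split: if_splits)
  next
    assume a: "{f x, f y, f z} = t \<and> ?sgn x y z = - 1"
    then have "(x, y, z) \<in> Or \<and> (f x, f z, f y) \<in> Q \<or> (x, z, y) \<in> Or \<and> (f x, f y, f z) \<in> Q"
      using orientation_swap[OF O s] orientation_swap[OF Q fs]
      by (auto simp: osign_def split: if_splits)
    moreover have "{x, y, z} = {x, z, y}" by auto
    ultimately show "{x, y, z} \<in> reversed_triangles T Or Q t f"
      using a s unfolding reversed_triangles_def by auto
  qed
  have "?sgn x y z = 1 \<or> ?sgn x y z = - 1"
    by (simp add: osign_def)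
  then show ?thesis
    unfolding pres rev by auto
qed

text \<open>The three-colouring takes each of its colours exactly once on every triangle and so
  gives the triangle a canonical order of vertices. This order may disagree with the orientation;
  \<open>osign\<close> records whether it does.\<close>

lemma bij_betw_ordered_triangles:
  assumes T: "simplicial_complex T" and c: "proper_coloring T {1, 2, 3} c" and S: "S \<subseteq> triangles T"
  shows "bij_betw (\<lambda>(x, y, z). {x, y, z}) {(x, y, z). {x, y, z} \<in> S \<and> c x = 1 \<and> c y = 2 \<and> c z = 3} S"
    (is "bij_betw ?set ?P S")
proof (rule bij_betw_imageI)
  show "inj_on ?set ?P"
  proof (clarsimp simp: inj_on_def)
    fix x y z x' y' z'
    assume c: "c x = Suc 0" "c y = 2" "c z = 3" "c x' = Suc 0" "c y' = 2" "c z' = 3"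
      and eq: "{x, y, z} = {x', y', z'}"
    have "x \<in> {x', y', z'}" "y \<in> {x', y', z'}" "z \<in> {x', y', z'}"
      using eq by blast+
    with c show "x = x' \<and> y = y' \<and> z = z'" by auto
  qed
  show "?set ` ?P = S"
  proof
    show "S \<subseteq> ?set ` ?P"
    proof
      fix s assume s: "s \<in> S"
      then have sT: "s \<in> triangles T" using S by blast
      then obtain x y z where xyz: "s = {x, y, z}"
        by (auto simp: triangles_def card_3_iff)
      have "distinct [c x, c y, c z]" "{c x, c y, c z} \<subseteq> {1, 2, 3}"
        using proper_coloring_triangle[OF T c] sT xyz by auto
      then have "1 \<in> c ` s" "2 \<in> c ` s" "3 \<in> c ` s"
        unfolding xyz by auto
      then obtain x1 x2 x3 where x: "x1 \<in> s" "x2 \<in> s" "x3 \<in> s" "c x1 = 1" "c x2 = 2" "c x3 = 3"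
        by (metis imageE)
      have "{x1, x2, x3} = s"
      proof (rule card_subset_eq)
        show "finite s" using sT by (rule finite_triangle)
        show "{x1, x2, x3} \<subseteq> s" using x by simp
        have "distinct [x1, x2, x3]" using x by auto
        then show "card {x1, x2, x3} = card s"
          using sT by (simp add: triangles_def)
      qed
      with x s show "s \<in> ?set ` ?P"
        by (intro image_eqI[of _ _ "(x1, x2, x3)"]) auto
    qed
  qed auto
qed

text \<open>The contributions of the triangles, ordered by \<open>c\<close>, are grouped by their
  triple of \<open>f\<close>-colours. Within a group the sign from \<open>Q\<close> is constant and
  factors out.\<close>

lemma deg_on_eq_signed_counts:
  assumes T: "closed_surface_triangulation T" and O: "orientation T Or"
    and Q: "orientation tetrahedron_boundary Q"
    and c: "proper_coloring T {1, 2, 3} c" and f: "four_coloring T f" and S: "S \<subseteq> triangles T"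
    and "finite t"
  shows "deg_on T Or Q t f S = (\<Sum>(u, v, w) | {u, v, w} = t.
    osign Q u v w * signed_count Or S (\<lambda>x. (c x, f x)) (1, u) (2, v) (3, w))"
proof -
  let ?P = "{(x, y, z). {x, y, z} \<in> S \<and> c x = 1 \<and> c y = 2 \<and> c z = 3}"
  let ?P' = "{(x, y, z). {x, y, z} \<in> S \<and> c x = 1 \<and> c y = 2 \<and> c z = 3 \<and> {f x, f y, f z} = t}"
  let ?U = "{(u, v, w). {u, v, w} = t}"
  let ?col = "\<lambda>(x, y, z). (f x, f y, f z)"
  let ?sgn = "\<lambda>(x, y, z). osign Or x y z * osign Q (f x) (f y) (f z)"
  have simp: "simplicial_complex T" and fin: "finite T"
    using T unfolding closed_surface_triangulation_def by auto
  have finP: "finite ?P"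
    by (rule finite_subset[OF _ finite_triples[OF fin S]]) auto
  have finP': "finite ?P'"
    by (rule finite_subset[OF _ finP]) auto
  have finU: "finite ?U"
    by (rule finite_subset[of _ "t \<times> t \<times> t"]) (use \<open>finite t\<close> in auto)
  have contribution: "of_bool ({x, y, z} \<in> preserved_triangles T Or Q t f)
       - of_bool ({x, y, z} \<in> reversed_triangles T Or Q t f)
     = (if {f x, f y, f z} = t then osign Or x y z * osign Q (f x) (f y) (f z) else 0)"
    if "{x, y, z} \<in> S" for x y z
  proof (rule triangle_contribution[OF O Q])
    show "{x, y, z} \<in> triangles T" using that S by blast
    then show "{f x, f y, f z} \<in> triangles tetrahedron_boundary"
      using proper_coloring_triangle[OF simp f[unfolded four_coloring_def]]
      by (simp add: triangles_tetrahedron_boundary)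
  qed
  have "deg_on T Or Q t f S = (\<Sum>(x, y, z)\<in>?P. of_bool ({x, y, z} \<in> preserved_triangles T Or Q t f)
       - of_bool ({x, y, z} \<in> reversed_triangles T Or Q t f))"
    unfolding deg_on_def
    by (subst sum.reindex_bij_betw[OF bij_betw_ordered_triangles[OF simp c S], symmetric])
       (simp add: case_prod_unfold)
  also have "\<dots> = (\<Sum>(x, y, z)\<in>?P. if {f x, f y, f z} = t then ?sgn (x, y, z) else 0)"
    by (rule sum.cong) (use contribution in auto)
  also have "\<dots> = sum ?sgn ?P'"
    by (rule sum.mono_neutral_cong_right[OF finP]) (auto split: if_splits)
  also have "\<dots> = (\<Sum>\<phi>\<in>?U. sum ?sgn {\<tau> \<in> ?P'. ?col \<tau> = \<phi>})"
    by (rule sum.group[OF finP' finU, symmetric]) auto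
  also have "\<dots> = (\<Sum>(u, v, w)\<in>?U.
      osign Q u v w * signed_count Or S (\<lambda>x. (c x, f x)) (1, u) (2, v) (3, w))"
  proof (rule sum.cong[OF refl])
    fix \<phi> assume "\<phi> \<in> ?U"
    then obtain u v w where \<phi>: "\<phi> = (u, v, w)" and "{u, v, w} = t" by blast
    then have "{\<tau> \<in> ?P'. ?col \<tau> = (u, v, w)}
      = {(x, y, z). {x, y, z} \<in> S \<and> (c x, f x) = (1, u) \<and> (c y, f y) = (2, v) \<and> (c z, f z) = (3, w)}"
      by auto
    then show "sum ?sgn {\<tau> \<in> ?P'. ?col \<tau> = \<phi>}
      = (case \<phi> of (u, v, w) \<Rightarrow>
          osign Q u v w * signed_count Or S (\<lambda>x. (c x, f x)) (1, u) (2, v) (3, w))"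
      unfolding \<phi> signed_count_def sum_distrib_left by (auto intro!: sum.cong)
  qed
  finally show ?thesis .
qed

section \<open>Equality over the 24 colour triples\<close>

text \<open>The omitted fourth colour acts as a blank tile: a move exchanges it with one of the three
  entries, and exchanging \<open>a\<close> with \<open>b\<close> is forbidden. The equations in the proof form a spanning
  tree of the graph of the 24 arrangements.\<close>

lemma constant_on_triples:
  fixes F :: "'b \<Rightarrow> 'b \<Rightarrow> 'b \<Rightarrow> 'c"
  assumes d: "distinct [a, b, p, q]"
    and move: "\<And>u v w w'. distinct [u, v, w, w'] \<Longrightarrow> {u, v, w, w'} = {a, b, p, q} \<Longrightarrow> {w, w'} \<noteq> {a, b}
      \<Longrightarrow> F u v w = F u v w' \<and> F v w u = F v w' u \<and> F w u v = F w' u v"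
    and "distinct [u, v, w]" "{u, v, w} \<subseteq> {a, b, p, q}"
  shows "F u v w = F a p q"
proof -
  have move3: "F u v w = F u v w'" and move2: "F v w u = F v w' u" and move1: "F w u v = F w' u v"
    if "distinct [u, v, w, w']" "{u, v, w, w'} = {a, b, p, q}" "{w, w'} \<noteq> {a, b}" for u v w w'
    using move[OF that] by auto
  have chain:
    "F a b q = F a p q" "F a p b = F a p q" "F p b q = F a b q" "F a b p = F a b q"
    "F q p b = F a p b" "F a q b = F a p b" "F p b a = F p b q" "F q b p = F a b p"
    "F a q p = F a b p" "F q a b = F q p b" "F p q b = F a q b" "F q b a = F p b a"
    "F p q a = F p b a" "F p a b = F q a b" "F q a p = F q a b" "F q p a = F q b a"
    "F b q a = F p q a" "F p a q = F p a b" "F b a p = F q a p" "F b p a = F q p a"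
    "F b q p = F b q a" "F b a q = F p a q" "F b p q = F b p a"
    by ((rule move1 move2 move3; use d in \<open>auto simp: doubleton_eq_iff\<close>))+
  have "u \<in> {a, b, p, q}" "v \<in> {a, b, p, q}" "w \<in> {a, b, p, q}"
    using assms(4) by auto
  \<comment> \<open>Read from left to right, each equation leads one step closer to the root
    \<open>F a p q\<close>, so rewriting ends there.\<close>
  then show ?thesis
    using assms(3) by (elim insertE emptyE; simp add: chain)
qed

lemma card_ordered_triples:
  assumes "card t = 3"
  shows "card {(x, y, z). {x, y, z} = t} = 6"
proof -
  obtain x y z where t: "t = {x, y, z}" "x \<noteq> y" "x \<noteq> z" "y \<noteq> z"
    using assms by (auto simp: card_3_iff)
  have "{(x', y', z'). {x', y', z'} = t}
    = {(x, y, z), (y, z, x), (z, x, y), (x, z, y), (z, y, x), (y, x, z)}" (is "?L = ?R")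
  proof
    show "?L \<subseteq> ?R"
    proof
      fix \<tau> assume "\<tau> \<in> ?L"
      then obtain x' y' z' where \<tau>: "\<tau> = (x', y', z')" and "{x', y', z'} = {x, y, z}"
        using t(1) by blast
      then show "\<tau> \<in> ?R"
        unfolding \<tau> by (intro triple_permutations) (use t in simp_all)
    qed
    show "?R \<subseteq> ?L"
      unfolding t(1) by auto
  qed
  then show ?thesis
    using t by simp
qed

section \<open>The degree over a region\<close>

text \<open>All 24 signed counts agree and six of them lie over \<open>t\<close>. The triple
  \<open>u\<close>, \<open>v\<close>, \<open>w\<close> need not lie over \<open>t\<close>; this
  freedom allows the two colourings to be evaluated at different triples.\<close>

lemma deg_on_region:
  assumes T: "closed_surface_triangulation T" and O: "orientation T Or"
    and Q: "orientation tetrahedron_boundary Q" and t: "t \<in> triangles tetrahedron_boundary"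
    and c: "proper_coloring T {1, 2, 3} c" and f: "four_coloring T f" and R: "R \<subseteq> triangles T"
    and d: "distinct [a, b, p, q]" "{a, b, p, q} = {1, 2, 3, 4}"
    and bd: "f ` vertices (region_boundary T R) \<subseteq> {p, q}"
    and uvw: "distinct [u, v, w]" "{u, v, w} \<subseteq> {1, 2, 3, 4}"
  shows "deg_on T Or Q t f R
    = 6 * (osign Q u v w * signed_count Or R (\<lambda>x. (c x, f x)) (1, u) (2, v) (3, w))"
proof -
  define G where "G i j k u v w = signed_count Or R (\<lambda>x. (c x, f x)) (i, u) (j, v) (k, w)"
    for i j k u v w
  define F where "F u v w = osign Q u v w * G 1 2 3 u v w" for u v w
  have simp: "simplicial_complex T"
    using T unfolding closed_surface_triangulation_def by auto
  have G_edge: "G i j k u v w + G i j k u v w' = 0"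
    if ijk: "distinct [i, j, k]" "{i, j, k} = {1, 2, 3}"
      and uv: "distinct [u, v, w, w']" "{u, v, w, w'} = {a, b, p, q}" "{w, w'} \<noteq> {a, b}"
    for i j k u v w w'
    unfolding G_def
  proof (rule signed_count_edge[OF T O R])
    fix x y assume xy: "(c x, f x) = (i, u)" "(c y, f y) = (j, v)"
    show "{x, y} \<notin> region_boundary T R"
    \<comment> \<open>A boundary edge carries the colours \<open>p\<close> and \<open>q\<close>,
      which leaves \<open>a\<close> and \<open>b\<close> for \<open>w\<close> and \<open>w'\<close>:
      exactly the forbidden exchange.\<close>
    proof
      assume "{x, y} \<in> region_boundary T R"
      then have "f x \<in> {p, q}" "f y \<in> {p, q}"
        using bd by (auto simp: vertices_def)
      then have "u \<in> {p, q}" "v \<in> {p, q}" using xy by auto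
      then have "{u, v} = {p, q}"
        using uv(1) by auto
      moreover have "{w, w'} = {u, v, w, w'} - {u, v}" "{a, b} = {a, b, p, q} - {p, q}"
        using uv(1) d(1) by auto
      ultimately have "{w, w'} = {a, b}"
        using uv(2) by metis
      with uv(3) show False by blast
    qed
  next
    fix x y z assume xyz: "{x, y, z} \<in> R" and xy: "(c x, f x) = (i, u)" "(c y, f y) = (j, v)"
    then have sT: "{x, y, z} \<in> triangles T" using R by blast
    have "c z \<in> {i, j, k}" "c z \<noteq> i" "c z \<noteq> j"
      unfolding ijk(2) using proper_coloring_triangle[OF simp c sT] xy by auto
    moreover have "f z \<in> {u, v, w, w'}" "f z \<noteq> u" "f z \<noteq> v"
      unfolding uv(2) d(2) using proper_coloring_triangle[OF simp f[unfolded four_coloring_def] sT] xy by auto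
    ultimately show "(c z, f z) = (k, w) \<or> (c z, f z) = (k, w')" by auto
  qed (use uv(1) in simp)
  have G_rotate: "G j k i v w u = G i j k u v w" for i j k u v w
    unfolding G_def by (rule signed_count_rotate[OF O])
  have F_eq: "F u v w = F a p q" if "distinct [u, v, w]" "{u, v, w} \<subseteq> {1, 2, 3, 4}" for u v w
  proof (rule constant_on_triples[OF d(1)])
    fix u v w w'
    assume uv: "distinct [u, v, w, w']" "{u, v, w, w'} = {a, b, p, q}" "{w, w'} \<noteq> {a, b}"
    have tri: "{u, v, w} \<in> triangles tetrahedron_boundary" "{u, v, w'} \<in> triangles tetrahedron_boundary"
      using uv(1) unfolding triangles_tetrahedron_boundary uv(2)[unfolded d(2), symmetric] by auto
    \<comment> \<open>The sign in the tetrahedron and the signed count both change sign under the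
      exchange, so their product \<open>F\<close> does not change.\<close>
    have "osign Q u v w' = - osign Q u v w"
      by (rule osign_adjacent[OF Q tri]) (use uv in auto)
    \<comment> \<open>With the exchanged colour kept last, the cyclic shifts of the
      \<open>c\<close>-colours 1, 2, 3 cover exchanges in the last, middle and first entry of
      \<open>F\<close>.\<close>
    moreover have "G 1 2 3 u v w' = - G 1 2 3 u v w" "G 3 1 2 u v w' = - G 3 1 2 u v w"
      "G 2 3 1 u v w' = - G 2 3 1 u v w"
      using G_edge[OF _ _ uv, of 1 2 3] G_edge[OF _ _ uv, of 3 1 2] G_edge[OF _ _ uv, of 2 3 1]
      by (auto simp: insert_commute)
    moreover have "osign Q v w u = osign Q u v w" "osign Q w u v = osign Q u v w" for w
      by (rule osign_rotate[OF Q], rule trans[OF osign_rotate[OF Q] osign_rotate[OF Q]])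
    moreover have "G 1 2 3 v w u = G 3 1 2 u v w" "G 1 2 3 w u v = G 2 3 1 u v w" for w
      by (rule G_rotate, rule trans[OF G_rotate G_rotate])
    ultimately show "F u v w = F u v w' \<and> F v w u = F v w' u \<and> F w u v = F w' u v"
      unfolding F_def by simp
  qed (simp_all only: that d(2))
  have F: "F u' v' w' = F u v w" if "{u', v', w'} = t" for u' v' w'
  proof -
    have "distinct [u', v', w']" "{u', v', w'} \<subseteq> {1, 2, 3, 4}"
      using t unfolding that[symmetric] triangles_tetrahedron_boundary by blast+
    then show ?thesis
      by (simp only: F_eq uvw)
  qed
  have "finite t" using t by (rule finite_triangle)
  then have "deg_on T Or Q t f R = (\<Sum>(u', v', w') | {u', v', w'} = t. F u' v' w')"
    unfolding F_def G_def by (rule deg_on_eq_signed_counts[OF T O Q c f R])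
  also have "\<dots> = (\<Sum>(u', v', w') | {u', v', w'} = t. F u v w)"
    using F by (intro sum.cong) auto
  also have "\<dots> = 6 * F u v w"
    using card_ordered_triples[of t] t by (simp add: case_prod_unfold triangles_def)
  finally show ?thesis
    unfolding F_def G_def .
qed

section \<open>The effect of a Kempe change\<close>

theorem theorem3p4:
  fixes T R :: "'a set set"
    and Or :: "('a \<times> 'a \<times> 'a) set"
    and Q :: "(nat \<times> nat \<times> nat) set"
    and f g :: "'a \<Rightarrow> nat"
    and t :: "nat set"
  assumes "closed_surface_triangulation T"
    and "orientable T"
    and "three_colorable T"
    and "orientation T Or"
    and "orientation tetrahedron_boundary Q"
    and "t \<in> triangles tetrahedron_boundary"
    and "four_coloring T f"
    and "four_coloring T g"
    and "kempe_change T R f g"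
  shows "[deg T Or Q t g = deg T Or Q t f] (mod 12)"
proof -
  note T = assms(1) and O = assms(4) and Q = assms(5) and t = assms(6)
  obtain c where c: "proper_coloring T {1, 2, 3} c"
    using assms(3) unfolding three_colorable_def by blast
  obtain a b where R: "R \<subseteq> triangles T" and ab: "a \<in> {1, 2, 3, 4}" "b \<in> {1, 2, 3, 4}" "a \<noteq> b"
    and bd: "f ` vertices (region_boundary T R) \<subseteq> {1, 2, 3, 4} - {a, b}"
    and g: "\<And>v. v \<in> vertices T \<Longrightarrow> g v = (if v \<in> \<Union>R then transpose a b (f v) else f v)"
    using assms(9) unfolding kempe_change_def by metis
  have "card ({1, 2, 3, 4} - {a, b}) = 2"
    using ab by (subst card_Diff_subset) auto
  then obtain p q where pq: "{1, 2, 3, 4} - {a, b} = {p, q}" "p \<noteq> q"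
    by (auto simp: card_2_iff)
  have pq_mem: "p \<in> {1, 2, 3, 4} - {a, b}" "q \<in> {1, 2, 3, 4} - {a, b}"
    unfolding pq(1) by auto
  then have d: "distinct [a, b, p, q]" "{a, b, p, q} = {1, 2, 3, 4}"
    using ab pq by auto
  have bd_f: "f ` vertices (region_boundary T R) \<subseteq> {p, q}"
    using bd pq by simp
  have triangles_vertices: "\<Union>(triangles T) \<subseteq> vertices T"
    by (auto simp: triangles_def vertices_def)
  \<comment> \<open>On the boundary \<open>f\<close> avoids \<open>a\<close> and \<open>b\<close>,
    so the transposition fixes its values. Hence \<open>g\<close> also satisfies the boundary
    condition of \<open>deg_on_region\<close>.\<close>
  have g_eq_f: "g v = f v" if "v \<in> vertices (region_boundary T R)" for v
  proof -
    have "v \<in> vertices T"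
      using that by (auto simp: region_boundary_def vertices_def)
    moreover have "f v \<noteq> a" "f v \<noteq> b"
      using that bd by auto
    ultimately show ?thesis
      using g by simp
  qed
  then have bd_g: "g ` vertices (region_boundary T R) \<subseteq> {p, q}"
    using bd_f by auto
  have outside: "deg_on T Or Q t g (triangles T - R) = deg_on T Or Q t f (triangles T - R)"
  proof (rule deg_on_cong)
    fix x assume "x \<in> \<Union>(triangles T - R)"
    then obtain s where s: "s \<in> triangles T - R" "x \<in> s" by blast
    show "g x = f x"
    \<comment> \<open>A vertex of an outside triangle may also belong to a triangle of
      \<open>R\<close>; it is then a boundary vertex, where the colourings agree.\<close>
    proof (cases "x \<in> \<Union>R")
      case True
      have "simplicial_complex T"
        using T unfolding closed_surface_triangulation_def by simp
      then have "{x} \<in> T"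
        by (rule face_mem[of _ s]) (use s in \<open>auto simp: triangles_def\<close>)
      with True s have "{x} \<in> region_boundary T R"
        unfolding region_boundary_def by auto
      then show ?thesis
        using g_eq_f by (auto simp: vertices_def)
    next
      case False
      then show ?thesis
        using g s triangles_vertices by auto
    qed
  qed
  \<comment> \<open>Only the first colour varies: \<open>g\<close> will be evaluated at
    \<open>a\<close> and \<open>f\<close> at \<open>b\<close>, which the Kempe change
    matches.\<close>
  let ?m = "\<lambda>f u. osign Q u p q * signed_count Or R (\<lambda>x. (c x, f x)) (1, u) (2, p) (3, q)"
  have "g v = transpose a b (f v)" if "v \<in> \<Union>R" for v
    using g[of v] that R triangles_vertices by (simp add: subset_iff) blast
  then have swapped: "g v = a \<longleftrightarrow> f v = b" "g v = p \<longleftrightarrow> f v = p" "g v = q \<longleftrightarrow> f v = q" if "v \<in> \<Union>R" for v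
    using that d(1) by (auto simp: transpose_def)
  have count: "signed_count Or R (\<lambda>x. (c x, g x)) (1, a) (2, p) (3, q)
    = signed_count Or R (\<lambda>x. (c x, f x)) (1, b) (2, p) (3, q)"
  proof -
    have "{x, y, z} \<in> R \<and> (c x, g x) = (1, a) \<and> (c y, g y) = (2, p) \<and> (c z, g z) = (3, q) \<longleftrightarrow>
      {x, y, z} \<in> R \<and> (c x, f x) = (1, b) \<and> (c y, f y) = (2, p) \<and> (c z, f z) = (3, q)" for x y z
    proof (cases "{x, y, z} \<in> R")
      case True
      then have "x \<in> \<Union>R" "y \<in> \<Union>R" "z \<in> \<Union>R" by blast+
      then show ?thesis by (simp add: swapped)
    qed simp
    then show ?thesis
      unfolding signed_count_def by simp
  qed
  \<comment> \<open>The source of the minus sign: the two faces of the tetrahedron on the edge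
    \<open>{p, q}\<close> induce opposite directions on it.\<close>
  have "{p, q, a} \<in> triangles tetrahedron_boundary" "{p, q, b} \<in> triangles tetrahedron_boundary"
    unfolding triangles_tetrahedron_boundary using d(1) ab pq_mem by auto
  then have "osign Q p q b = - osign Q p q a"
    by (rule osign_adjacent[OF Q]) (use ab in simp)
  then have "osign Q b p q = - osign Q a p q"
    using osign_rotate[OF Q] by metis
  then have m: "?m g a = - ?m f b"
    unfolding count by simp
  have inside: "deg_on T Or Q t g R = 6 * ?m g a" "deg_on T Or Q t f R = 6 * ?m f b"
    by (rule deg_on_region[OF T O Q t c _ R d]; use assms(7,8) bd_f bd_g d(1) ab pq_mem in auto)+
  have "finite T"
    using T unfolding closed_surface_triangulation_def by simp
  then have split: "deg T Or Q t h = deg_on T Or Q t h (triangles T - R) + deg_on T Or Q t h R" for h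
    unfolding deg_eq_deg_on[OF \<open>finite T\<close>] deg_on_def
    by (intro sum.subset_diff R) (simp add: triangles_def)
  \<comment> \<open>The outside parts cancel, and six times a number is replaced by six times its
    negative.\<close>
  have "deg T Or Q t g - deg T Or Q t f = 12 * - ?m f b"
    unfolding split outside inside m by simp
  then show ?thesis
    unfolding cong_iff_dvd_diff by (metis dvd_triv_left)
qed

end
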